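(* Let $A$ be one of the following Banach function algebras: $C(X)$ for some compact Hausdorff space $X$; $\mathrm{Lip}(X)$ for some compact metric space $X$; or $\mathrm{AC}([0,1])$. Let $\varphi\colon A\to\mathbb{C}$ be a (not necessarily linear) multiplicative spectral function on $A$. Then the following are equivalent: (i) $\varphi$ is a character. (ii) $\varphi$ is continuous. (iii) $1\notin\mathrm{span}(\ker(\varphi))$.
   Context: $C(X)$ is the algebra of continuous complex-valued functions on $X$ with the supremum norm $\|\cdot\|_X$. $\mathrm{Lip}(X)$ is the algebra of complex-valued Lipschitz functions on the compact metric space $X$ with norm $\|f\|=\|f\|_X+p(f)$, where $p(f)$ is the Lipschitz constant of $f$. $\mathrm{AC}([0,1])$ is the algebra of complex-valued absolutely continuous functions on $[0,1]$ with norm $\|f\|=\|f\|_{[0,1]}+\mathrm{var}(f)$, where $\mathrm{var}(f)$ is the total variation of $f$. A function $\varphi\colon A\to\mathbb{C}$ is spectral if $\varphi(f)\in\sigma(f)$ for all $f\in A$, where $\sigma(f)$ is the spectrum of $f$ in $A$, and multiplicative if $\varphi(fg)=\varphi(f)\varphi(g)$ for all $f,g\in A$. Here $\ker(\varphi)=\{f\in A:\varphi(f)=0\}$, and $\mathrm{span}$ is the complex linear span. A character is a nonzero multiplicative complex-linear functional. Continuity is with respect to the norm of $A$. *)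

theory Defs
  imports "HOL-Analysis.Analysis" "HOL-Library.Function_Algebras"
begin

text \<open>
  A normed algebra of complex functions on a set of points. The functions on the points are
  represented by the total functions vanishing elsewhere, so that sums, products and scalar
  multiples are the pointwise ones and the unit is the indicator function of the points.
\<close>

record 'a fun_alg =
  points :: "'a set"
  funs :: "('a \<Rightarrow> complex) set"
  alg_norm :: "('a \<Rightarrow> complex) \<Rightarrow> real"

definition unit_fun :: "'a fun_alg \<Rightarrow> 'a \<Rightarrow> complex" where
  "unit_fun A = indicator (points A)"

definition fscale :: "complex \<Rightarrow> ('a \<Rightarrow> complex) \<Rightarrow> 'a \<Rightarrow> complex" where
  "fscale c f = (\<lambda>x. c * f x)"

abbreviation cspan :: "('a \<Rightarrow> complex) set \<Rightarrow> ('a \<Rightarrow> complex) set" where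
  "cspan \<equiv> module.span fscale"

definition sup_norm :: "'a set \<Rightarrow> ('a \<Rightarrow> complex) \<Rightarrow> real" where
  "sup_norm S f = (SUP x\<in>S. cmod (f x))"

definition C_alg :: "'a topology \<Rightarrow> 'a fun_alg" where
  "C_alg X =
    \<lparr>points = topspace X,
     funs = {f. continuous_map X euclidean f \<and> (\<forall>x. x \<notin> topspace X \<longrightarrow> f x = 0)},
     alg_norm = sup_norm (topspace X)\<rparr>"

definition lip_const :: "'a metric \<Rightarrow> ('a \<Rightarrow> complex) \<Rightarrow> real" where
  "lip_const m f =
    Inf {L. 0 \<le> L \<and> (\<forall>x\<in>mspace m. \<forall>y\<in>mspace m. dist (f x) (f y) \<le> L * mdist m x y)}"

definition Lip_alg :: "'a metric \<Rightarrow> 'a fun_alg" where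
  "Lip_alg m =
    \<lparr>points = mspace m,
     funs = {f. Lipschitz_continuous_map m euclidean_metric f \<and> (\<forall>x. x \<notin> mspace m \<longrightarrow> f x = 0)},
     alg_norm = (\<lambda>f. sup_norm (mspace m) f + lip_const m f)\<rparr>"

text \<open>
  The elements of a division are compact intervals \<open>k = {Inf k..Sup k}\<close> with pairwise disjoint
  interiors; degenerate ones are allowed but contribute nothing to the sums below.
\<close>

definition increment_sum :: "(real \<Rightarrow> complex) \<Rightarrow> real set set \<Rightarrow> real" where
  "increment_sum f d = (\<Sum>k\<in>d. cmod (f (Sup k) - f (Inf k)))"

definition absolutely_continuous_on :: "real set \<Rightarrow> (real \<Rightarrow> complex) \<Rightarrow> bool" where
  "absolutely_continuous_on S f \<longleftrightarrow>
    (\<forall>\<epsilon>>0. \<exists>\<delta>>0. \<forall>d t. d division_of t \<and> t \<subseteq> S \<and> (\<Sum>k\<in>d. Sup k - Inf k) < \<delta> \<longrightarrow>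
       increment_sum f d < \<epsilon>)"

definition total_variation :: "real \<Rightarrow> real \<Rightarrow> (real \<Rightarrow> complex) \<Rightarrow> real" where
  "total_variation a b f = (SUP d\<in>{d. d division_of {a..b}}. increment_sum f d)"

definition AC_alg :: "real fun_alg" where
  "AC_alg =
    \<lparr>points = {0..1},
     funs = {f. absolutely_continuous_on {0..1} f \<and> (\<forall>x. x \<notin> {0..1} \<longrightarrow> f x = 0)},
     alg_norm = (\<lambda>f. sup_norm {0..1} f + total_variation 0 1 f)\<rparr>"

text \<open>
  In the following, only the values of \<open>\<phi>\<close> on \<open>funs A\<close> are relevant.
\<close>

definition spectrum :: "'a fun_alg \<Rightarrow> ('a \<Rightarrow> complex) \<Rightarrow> complex set" where
  "spectrum A f =
    {c. \<not> (\<exists>g\<in>funs A. (fscale c (unit_fun A) - f) * g = unit_fun A)}"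

definition spectral :: "'a fun_alg \<Rightarrow> (('a \<Rightarrow> complex) \<Rightarrow> complex) \<Rightarrow> bool" where
  "spectral A \<phi> \<longleftrightarrow> (\<forall>f\<in>funs A. \<phi> f \<in> spectrum A f)"

definition multiplicative :: "'a fun_alg \<Rightarrow> (('a \<Rightarrow> complex) \<Rightarrow> complex) \<Rightarrow> bool" where
  "multiplicative A \<phi> \<longleftrightarrow> (\<forall>f\<in>funs A. \<forall>g\<in>funs A. \<phi> (f * g) = \<phi> f * \<phi> g)"

definition complex_linear :: "'a fun_alg \<Rightarrow> (('a \<Rightarrow> complex) \<Rightarrow> complex) \<Rightarrow> bool" where
  "complex_linear A \<phi> \<longleftrightarrow>
    (\<forall>f\<in>funs A. \<forall>g\<in>funs A. \<phi> (f + g) = \<phi> f + \<phi> g) \<and>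
    (\<forall>c. \<forall>f\<in>funs A. \<phi> (fscale c f) = c * \<phi> f)"

definition character :: "'a fun_alg \<Rightarrow> (('a \<Rightarrow> complex) \<Rightarrow> complex) \<Rightarrow> bool" where
  "character A \<phi> \<longleftrightarrow>
    (\<exists>f\<in>funs A. \<phi> f \<noteq> 0) \<and> multiplicative A \<phi> \<and> complex_linear A \<phi>"

definition norm_continuous :: "'a fun_alg \<Rightarrow> (('a \<Rightarrow> complex) \<Rightarrow> complex) \<Rightarrow> bool" where
  "norm_continuous A \<phi> \<longleftrightarrow>
    (\<forall>f\<in>funs A. \<forall>\<epsilon>>0. \<exists>\<delta>>0. \<forall>g\<in>funs A.
       alg_norm A (g - f) < \<delta> \<longrightarrow> cmod (\<phi> g - \<phi> f) < \<epsilon>)"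

definition alg_ker :: "'a fun_alg \<Rightarrow> (('a \<Rightarrow> complex) \<Rightarrow> complex) \<Rightarrow> ('a \<Rightarrow> complex) set" where
  "alg_ker A \<phi> = {f \<in> funs A. \<phi> f = 0}"

text \<open>This makes the facts about \<open>module.span\<close> available for \<^const>\<open>fscale\<close>.\<close>

lemma vector_space_fscale: "vector_space fscale"
  by unfold_locales (auto simp: fscale_def fun_eq_iff algebra_simps)

end

theory Submission
  imports Defs
begin

text \<open>
  All three algebras consist of continuous functions on a compact space and are closed under sums
  and under composition with functions that are Lipschitz on the range. For real \<open>g\<close> in such an
  algebra, \<open>L g = ln (\<phi> (exp g))\<close> is additive with \<open>L g\<close> in the range of \<open>g\<close>. Evaluating \<open>\<phi>\<close> at
  \<open>exp (g + \<i> g)\<close> gives \<open>\<phi> (exp (\<i> g)) = exp (\<i> L g)\<close>, so looking at \<open>exp (f + \<i> g)\<close> the pair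
  \<open>(L f, L g)\<close> is a joint value of \<open>(f, g)\<close>. With \<open>f = g\<^sup>2\<close> this makes \<open>L\<close> multiplicative, and sums
  of squares together with compactness yield a point \<open>x\<close> with \<open>L g = g x\<close> for all real \<open>g\<close>.

  If \<open>\<phi>\<close> is continuous, passing from \<open>\<bar>f\<bar>\<^sup>2 + c\<close> to \<open>\<bar>f\<bar>\<^sup>2\<close> shows that the kernel of \<open>\<phi>\<close> vanishes at
  \<open>x\<close>. If \<open>1\<close> is not in the span of the kernel, the kernel has a common zero by compactness. In both
  cases \<open>\<phi>\<close> is the evaluation at that point, by a localisation argument.
\<close>

section \<open>Function algebras closed under Lipschitz functional calculus\<close>

text \<open>These are properties shared by the three algebras. Elements have compact range, so
  \<open>comp_mem\<close> together with sums already yields products, conjugates, exponentials,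
  inverses and logarithms. The norm enters only through two bounds: it dominates the values of an
  element, and it is controlled on constants.\<close>

locale lipschitz_algebra =
  fixes A :: "'a fun_alg" and X :: "'a topology"
  assumes compact: "compact_space X"
    and topspace_eq: "topspace X = points A"
    and continuous: "f \<in> funs A \<Longrightarrow> continuous_map X euclidean f"
    and vanish: "f \<in> funs A \<Longrightarrow> x \<notin> points A \<Longrightarrow> f x = 0"
    and zero_mem: "0 \<in> funs A"
    and add_mem: "f \<in> funs A \<Longrightarrow> g \<in> funs A \<Longrightarrow> f + g \<in> funs A"
    and comp_mem: "f \<in> funs A \<Longrightarrow> L-lipschitz_on (f ` points A) h \<Longrightarrow>
      (\<lambda>x. if x \<in> points A then h (f x) else 0) \<in> funs A"
    and norm_ge: "f \<in> funs A \<Longrightarrow> x \<in> points A \<Longrightarrow> cmod (f x) \<le> alg_norm A f"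
    and norm_const: "points A \<noteq> {} \<Longrightarrow> alg_norm A (fscale c (unit_fun A)) \<le> cmod c"
begin

text \<open>\<open>h\<close> need not fix \<open>0\<close>, so the composition is reset to
  \<open>0\<close> off the points to stay within the representation of functions.\<close>

definition lift :: "(complex \<Rightarrow> complex) \<Rightarrow> ('a \<Rightarrow> complex) \<Rightarrow> 'a \<Rightarrow> complex" where
  "lift h f = (\<lambda>x. if x \<in> points A then h (f x) else 0)"

lemma lift_apply: "x \<in> points A \<Longrightarrow> lift h f x = h (f x)"
  by (simp add: lift_def)

lemma lift_eqI:
  assumes "\<And>x. x \<in> points A \<Longrightarrow> g x = h (f x)" "\<And>x. x \<notin> points A \<Longrightarrow> g x = 0"
  shows "lift h f = g"
  using assms by (auto simp: lift_def fun_eq_iff)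

lemma lift_mem: "f \<in> funs A \<Longrightarrow> L-lipschitz_on (f ` points A) h \<Longrightarrow> lift h f \<in> funs A"
  unfolding lift_def by (rule comp_mem)

lemma funs_eqI:
  assumes "f \<in> funs A" "g \<in> funs A" "\<And>x. x \<in> points A \<Longrightarrow> f x = g x"
  shows "f = g"
  using assms vanish by (metis ext)

lemma compact_image: "f \<in> funs A \<Longrightarrow> compact (f ` points A)"
  using continuous[of f] compact topspace_eq
  by (metis compactin_euclidean_iff compact_space_def image_compactin)

lemma bounded_image:
  assumes "f \<in> funs A"
  obtains R where "R > 0" "\<And>x. x \<in> points A \<Longrightarrow> cmod (f x) \<le> R"
  using compact_image[OF assms] by (auto dest!: compact_imp_bounded simp: bounded_pos)

lemma scale_mem: "f \<in> funs A \<Longrightarrow> fscale c f \<in> funs A"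
proof -
  assume f: "f \<in> funs A"
  have "(cmod c)-lipschitz_on (f ` points A) (\<lambda>z. c * z)"
    by (rule lipschitz_onI) (auto simp: dist_norm norm_mult simp flip: right_diff_distrib)
  moreover have "lift (\<lambda>z. c * z) f = fscale c f"
    by (rule lift_eqI) (auto simp: fscale_def vanish[OF f])
  ultimately show ?thesis using lift_mem[OF f] by metis
qed

lemma unit_apply: "x \<in> points A \<Longrightarrow> unit_fun A x = 1"
  by (simp add: unit_fun_def)

lemma unit_mem: "unit_fun A \<in> funs A"
proof -
  \<comment> \<open>The axioms provide only the zero element, so the unit is obtained from it by
    applying a constant function.\<close>
  have "0-lipschitz_on ((0::'a\<Rightarrow>complex) ` points A) (\<lambda>z. 1::complex)"
    by (rule lipschitz_onI) auto
  moreover have "lift (\<lambda>z. 1) 0 = unit_fun A"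
    by (rule lift_eqI) (auto simp: unit_fun_def)
  ultimately show ?thesis using lift_mem[OF zero_mem] by metis
qed

lemma const_mem: "fscale c (unit_fun A) \<in> funs A"
  by (intro scale_mem unit_mem)

lemma const_apply: "x \<in> points A \<Longrightarrow> fscale c (unit_fun A) x = c"
  by (simp add: fscale_def unit_apply)

lemma diff_mem: "f \<in> funs A \<Longrightarrow> g \<in> funs A \<Longrightarrow> f - g \<in> funs A"
proof -
  assume "f \<in> funs A" "g \<in> funs A"
  moreover have "f - g = f + fscale (-1) g" by (auto simp: fscale_def fun_eq_iff)
  ultimately show ?thesis by (metis add_mem scale_mem)
qed

lemma square_mem:
  assumes f: "f \<in> funs A"
  shows "f * f \<in> funs A"
proof -
  obtain R where R: "R > 0" "\<And>x. x \<in> points A \<Longrightarrow> cmod (f x) \<le> R"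
    using bounded_image[OF f] by blast
  have "(2 * R)-lipschitz_on (f ` points A) (\<lambda>z. z * z)"
  proof (rule lipschitz_onI)
    fix z w assume "z \<in> f ` points A" "w \<in> f ` points A"
    then have "cmod z \<le> R" "cmod w \<le> R" using R by auto
    then have "cmod (z + w) \<le> 2 * R" using norm_triangle_ineq[of z w] by linarith
    then have "cmod (z + w) * cmod (z - w) \<le> 2 * R * cmod (z - w)"
      by (intro mult_right_mono) auto
    moreover have "z * z - w * w = (z + w) * (z - w)" by (simp add: algebra_simps)
    ultimately show "dist (z * z) (w * w) \<le> 2 * R * dist z w"
      by (simp add: dist_norm norm_mult)
  qed (use R in auto)
  from lift_mem[OF f this] have "lift (\<lambda>z. z * z) f \<in> funs A" .
  moreover have "lift (\<lambda>z. z * z) f = f * f"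
    using vanish[OF f] by (auto simp: lift_def fun_eq_iff)
  ultimately show ?thesis by simp
qed

text \<open>Polarisation: \<open>comp_mem\<close> acts on one element at a time, so products are
  recovered from squares of sums and differences.\<close>

lemma mult_mem:
  assumes "f \<in> funs A" "g \<in> funs A"
  shows "f * g \<in> funs A"
proof -
  have "f * g = fscale (1/4) ((f + g) * (f + g) - (f - g) * (f - g))"
    by (auto simp: fscale_def fun_eq_iff algebra_simps)
  then show ?thesis using assms by (simp add: scale_mem diff_mem square_mem add_mem)
qed

lemma cnj_mem:
  assumes f: "f \<in> funs A"
  shows "lift cnj f \<in> funs A"
  by (rule lift_mem[OF f, of 1])
    (auto intro!: lipschitz_onI simp: dist_norm simp flip: complex_cnj_diff)

lemma exp_mem:
  assumes f: "f \<in> funs A"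
  shows "lift exp f \<in> funs A"
proof -
  obtain R where R: "R > 0" "\<And>x. x \<in> points A \<Longrightarrow> cmod (f x) \<le> R"
    using bounded_image[OF f] by blast
  \<comment> \<open>The estimate is made on a disc containing the range because the bound through
    the derivative needs a convex set.\<close>
  have "(exp R)-lipschitz_on (cball (0::complex) R) exp"
  proof (rule lipschitz_onI)
    fix z w :: complex assume zw: "z \<in> cball 0 R" "w \<in> cball 0 R"
    show "dist (exp z) (exp w) \<le> exp R * dist z w"
      unfolding dist_norm
    proof (rule field_differentiable_bound[OF convex_cball _ _ zw])
      fix v :: complex assume "v \<in> cball 0 R"
      then show "cmod (exp v) \<le> exp R"
        using complex_Re_le_cmod[of v] by (simp del: complex_Re_le_cmod)
    qed (auto intro!: derivative_eq_intros)
  qed auto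
  then have "(exp R)-lipschitz_on (f ` points A) exp"
    by (rule lipschitz_on_subset) (use R in auto)
  then show ?thesis by (rule lift_mem[OF f])
qed

lemma bounded_away_from_zero:
  assumes f: "f \<in> funs A" and nz: "\<And>x. x \<in> points A \<Longrightarrow> f x \<noteq> 0"
  obtains d where "d > 0" "\<And>x. x \<in> points A \<Longrightarrow> d \<le> cmod (f x)"
proof -
  have "0 \<notin> f ` points A" using nz by auto
  then obtain d where d: "d > 0" "\<forall>z\<in>f ` points A. d \<le> dist 0 z"
    using separate_point_closed[OF compact_imp_closed[OF compact_image[OF f]]] by blast
  then show ?thesis using that[of d] by auto
qed

text \<open>A zero-free element is bounded away from \<open>0\<close> by compactness, and inversion
  is Lipschitz there. Hence the absence of zeros suffices for invertibility in the algebra, and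
  spectra are contained in ranges.\<close>

lemma inverse_mem:
  assumes f: "f \<in> funs A" and nz: "\<And>x. x \<in> points A \<Longrightarrow> f x \<noteq> 0"
  shows "lift inverse f \<in> funs A"
proof -
  obtain d where d: "d > 0" "\<And>x. x \<in> points A \<Longrightarrow> d \<le> cmod (f x)"
    using bounded_away_from_zero[OF f nz] by blast
  have "(inverse (d * d))-lipschitz_on (f ` points A) inverse"
  proof (rule lipschitz_onI)
    fix z w assume "z \<in> f ` points A" "w \<in> f ` points A"
    then have zw: "d \<le> cmod z" "d \<le> cmod w" using d by auto
    then have "z \<noteq> 0" "w \<noteq> 0" using d by auto
    then have "inverse z - inverse w = inverse (z * w) * (w - z)" by (simp add: field_simps)
    moreover have "inverse (cmod z * cmod w) \<le> inverse (d * d)"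
      using zw d by (intro le_imp_inverse_le mult_mono) auto
    ultimately show "dist (inverse z) (inverse w) \<le> inverse (d * d) * dist z w"
      by (simp only: dist_norm norm_mult norm_inverse norm_minus_commute[of z w] mult_right_mono
        norm_ge_zero)
  qed (use d in auto)
  then show ?thesis by (rule lift_mem[OF f])
qed

text \<open>\<open>ln\<close> is Lipschitz with constant \<open>1 / c\<close> to the right of
  \<open>c\<close>. This is used to write an element with real values above \<open>c\<close> as an
  exponential.\<close>

lemma log_mem:
  assumes f: "f \<in> funs A" and c: "c > 0" and pos: "\<And>x. x \<in> points A \<Longrightarrow> c \<le> Re (f x)"
  shows "lift (\<lambda>z. complex_of_real (ln (Re z))) f \<in> funs A"
proof -
  have *: "ln a - ln b \<le> inverse c * \<bar>a - b\<bar>" if "a \<ge> c" "b \<ge> c" for a b :: real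
  proof -
    have "ln a - ln b \<le> (a - b) / b"
      using that c ln_diff_le by simp
    also have "\<dots> \<le> \<bar>a - b\<bar> / b" using that c by (intro divide_right_mono) auto
    also have "\<dots> \<le> \<bar>a - b\<bar> / c" using that c by (intro divide_left_mono) auto
    finally show ?thesis by (simp add: field_simps)
  qed
  have "(inverse c)-lipschitz_on (f ` points A) (\<lambda>z. complex_of_real (ln (Re z)))"
  proof (rule lipschitz_onI)
    fix z w assume "z \<in> f ` points A" "w \<in> f ` points A"
    then have zw: "c \<le> Re z" "c \<le> Re w" using pos by auto
    have "\<bar>ln (Re z) - ln (Re w)\<bar> \<le> inverse c * \<bar>Re z - Re w\<bar>"
      using *[OF zw] *[OF zw(2,1)] by (simp add: abs_minus_commute abs_le_iff)
    also have "\<dots> \<le> inverse c * dist z w"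
      using c abs_Re_le_cmod[of "z - w"] by (intro mult_left_mono) (auto simp: dist_norm)
    finally show "dist (complex_of_real (ln (Re z))) (of_real (ln (Re w))) \<le> inverse c * dist z w"
      by (simp add: dist_norm flip: of_real_diff)
  qed (use c in auto)
  then show ?thesis by (rule lift_mem[OF f])
qed

lemma sum_mem: "(\<And>i. i \<in> I \<Longrightarrow> f i \<in> funs A) \<Longrightarrow> sum f I \<in> funs A"
  by (induction I rule: infinite_finite_induct) (auto simp: zero_mem add_mem)

lemma sum_fun_apply: "sum f I x = (\<Sum>i\<in>I. f i x)" for f :: "'i \<Rightarrow> 'a \<Rightarrow> complex"
  by (induction I rule: infinite_finite_induct) auto

text \<open>Each condition \<open>f x = c f\<close> defines a closed set, so the finite intersection
  property of the compact space applies.\<close>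

lemma common_point:
  assumes "F \<subseteq> funs A"
    and fin: "\<And>G. finite G \<Longrightarrow> G \<subseteq> F \<Longrightarrow> \<exists>x\<in>points A. \<forall>f\<in>G. f x = c f"
  obtains x where "x \<in> points A" "\<And>f. f \<in> F \<Longrightarrow> f x = c f"
proof (cases "F = {}")
  \<comment> \<open>The intersection of the empty family is \<open>UNIV\<close>, so a member of the
    points has to come from the hypothesis for \<open>G = {}\<close>.\<close>
  case True
  then show ?thesis using that fin[of "{}"] by auto
next
  case False
  define Z where "Z f = {x \<in> topspace X. f x \<in> {c f}}" for f
  have "\<Inter>(Z ` F) \<noteq> {}"
  proof (rule compact_space_fip[THEN iffD1, rule_format, OF compact])
    show "(\<forall>C\<in>Z ` F. closedin X C) \<and> (\<forall>H. finite H \<and> H \<subseteq> Z ` F \<longrightarrow> \<Inter>H \<noteq> {})"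
    proof (intro conjI ballI allI impI)
      fix C assume "C \<in> Z ` F"
      then show "closedin X C"
        using assms(1) unfolding Z_def
        by (fastforce intro: closedin_continuous_map_preimage[OF continuous])
    next
      fix H assume "finite H \<and> H \<subseteq> Z ` F"
      then obtain G where G: "finite G" "G \<subseteq> F" "H = Z ` G"
        by (meson finite_subset_image)
      with fin[OF G(1,2)] show "\<Inter>H \<noteq> {}" by (auto simp: Z_def topspace_eq)
    qed
  qed
  then obtain x where "x \<in> \<Inter>(Z ` F)" by blast
  then show ?thesis using that[of x] False by (auto simp: Z_def topspace_eq)
qed

section \<open>Real-valued elements\<close>

definition real_funs :: "('a \<Rightarrow> complex) set" where
  "real_funs = {g \<in> funs A. \<forall>x. g x \<in> \<real>}"

lemma real_funs_mem: "g \<in> real_funs \<Longrightarrow> g \<in> funs A"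
  by (simp add: real_funs_def)

lemma real_funs_Re: "g \<in> real_funs \<Longrightarrow> g x = of_real (Re (g x))"
  by (auto simp: real_funs_def elim: Reals_cases)

lemma real_funs_add: "f \<in> real_funs \<Longrightarrow> g \<in> real_funs \<Longrightarrow> f + g \<in> real_funs"
  by (simp add: real_funs_def add_mem)

lemma real_funs_mult: "f \<in> real_funs \<Longrightarrow> g \<in> real_funs \<Longrightarrow> f * g \<in> real_funs"
  by (simp add: real_funs_def mult_mem)

lemma real_funs_scale: "f \<in> real_funs \<Longrightarrow> fscale (of_real c) f \<in> real_funs"
  by (simp add: real_funs_def fscale_def scale_mem[unfolded fscale_def])

lemma real_funs_const: "fscale (of_real c) (unit_fun A) \<in> real_funs"
  by (simp add: real_funs_def const_mem) (simp add: fscale_def unit_fun_def indicator_def)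

lemma real_funs_sum: "(\<And>i. i \<in> I \<Longrightarrow> f i \<in> real_funs) \<Longrightarrow> sum f I \<in> real_funs"
  by (simp add: real_funs_def sum_mem sum_fun_apply)

lemma lift_exp_add: "lift exp (f + g) = lift exp f * lift exp g"
  by (auto simp: lift_def fun_eq_iff exp_add)

end

section \<open>The additive functional obtained from exponentials\<close>

locale multiplicative_spectral = lipschitz_algebra +
  fixes \<phi> :: "('a \<Rightarrow> complex) \<Rightarrow> complex"
  assumes multiplicative: "multiplicative A \<phi>"
    and spectral: "spectral A \<phi>"
begin

lemma mult: "f \<in> funs A \<Longrightarrow> g \<in> funs A \<Longrightarrow> \<phi> (f * g) = \<phi> f * \<phi> g"
  using multiplicative by (simp add: multiplicative_def)

text \<open>If \<open>\<phi> f\<close> were not a value of \<open>f\<close>, then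
  \<open>\<phi> f\<close> times the unit minus \<open>f\<close> would have no zero and so be
  invertible, putting \<open>\<phi> f\<close> outside the spectrum. Spectrality is used only through
  this lemma.\<close>

lemma value_attained:
  assumes f: "f \<in> funs A"
  obtains x where "x \<in> points A" "\<phi> f = f x"
proof (rule ccontr)
  assume "\<not> thesis"
  with that have ne: "f x \<noteq> \<phi> f" if "x \<in> points A" for x using \<open>x \<in> points A\<close> by metis
  define g where "g = fscale (\<phi> f) (unit_fun A) - f"
  have g: "g \<in> funs A" unfolding g_def by (intro diff_mem const_mem f)
  have gx: "g x = \<phi> f - f x" if "x \<in> points A" for x
    using that by (simp add: g_def const_apply)
  have nz: "g x \<noteq> 0" if "x \<in> points A" for x using gx[OF that] ne[OF that] by simp
  have gi: "lift inverse g \<in> funs A" using inverse_mem[OF g] nz by blast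
  have "g * lift inverse g = unit_fun A"
    by (rule funs_eqI) (use g gi nz in \<open>auto simp: mult_mem unit_mem lift_apply unit_apply\<close>)
  then have "\<phi> f \<notin> spectrum A f" using gi by (auto simp: spectrum_def g_def)
  then show False using spectral f by (simp add: spectral_def)
qed

lemma nonempty: "points A \<noteq> {}"
  using value_attained[OF zero_mem] by blast

lemma const_value: "\<phi> (fscale c (unit_fun A)) = c"
  using value_attained[OF const_mem[of c]] const_apply by metis

lemma unit_value: "\<phi> (unit_fun A) = 1"
  using value_attained[OF unit_mem] unit_apply by metis

text \<open>For real \<open>g\<close> the value \<open>\<phi> (lift exp g)\<close> is a positive
  real by \<open>exp_value\<close>; the modulus merely turns it into an argument of the real
  logarithm.\<close>

definition log_value :: "('a \<Rightarrow> complex) \<Rightarrow> real" where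
  "log_value g = ln (cmod (\<phi> (lift exp g)))"

lemma exp_value:
  assumes g: "g \<in> real_funs"
  shows "\<phi> (lift exp g) = exp (of_real (log_value g))"
proof -
  obtain x where x: "x \<in> points A" "\<phi> (lift exp g) = lift exp g x"
    using value_attained[OF exp_mem[OF real_funs_mem[OF g]]] .
  then have "\<phi> (lift exp g) = exp (of_real (Re (g x)))"
    using real_funs_Re[OF g, of x] by (simp add: lift_apply)
  then show ?thesis by (simp add: log_value_def)
qed

lemma exp_value_add:
  assumes "f \<in> funs A" "g \<in> funs A"
  shows "\<phi> (lift exp (f + g)) = \<phi> (lift exp f) * \<phi> (lift exp g)"
  using assms by (simp add: lift_exp_add mult exp_mem)

lemma log_value_add:
  assumes f: "f \<in> real_funs" and g: "g \<in> real_funs"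
  shows "log_value (f + g) = log_value f + log_value g"
proof -
  have "exp (complex_of_real (log_value (f + g))) = exp (of_real (log_value f + log_value g))"
    using exp_value_add[of f g] assms
    by (simp add: exp_value real_funs_add real_funs_mem exp_add)
  then show ?thesis by (simp only: exp_of_real of_real_eq_iff exp_inj_iff)
qed

lemma log_value_const: "log_value (fscale (of_real c) (unit_fun A)) = c"
proof -
  have "lift exp (fscale (of_real c) (unit_fun A)) = fscale (exp (of_real c)) (unit_fun A)"
    by (auto simp: lift_def fscale_def unit_fun_def fun_eq_iff)
  then show ?thesis by (simp add: log_value_def const_value)
qed

lemma log_value_zero: "log_value 0 = 0"
proof -
  have "0 \<in> real_funs" by (simp add: real_funs_def zero_mem)
  from log_value_add[OF this this] show ?thesis by simp
qed

lemma log_value_sum: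
  "(\<And>i. i \<in> I \<Longrightarrow> f i \<in> real_funs) \<Longrightarrow> log_value (sum f I) = (\<Sum>i\<in>I. log_value (f i))"
  by (induction I rule: infinite_finite_induct)
    (auto simp: log_value_zero log_value_add real_funs_sum)

text \<open>Additivity gives homogeneity for natural factors, which is enough to undo a scaling by
  \<open>1 / n\<close>.\<close>

lemma log_value_scale_of_nat:
  assumes g: "g \<in> real_funs"
  shows "log_value (fscale (of_real (real n)) g) = real n * log_value g"
proof (induction n)
  case 0
  have "fscale (of_real (real 0)) g = 0" by (auto simp: fscale_def)
  then show ?case by (metis log_value_zero mult_zero_left of_nat_0)
next
  case (Suc n)
  have "fscale (of_real (real (Suc n))) g = fscale (of_real (real n)) g + g"
    by (auto simp: fscale_def fun_eq_iff algebra_simps)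
  then have "log_value (fscale (of_real (real (Suc n))) g)
      = log_value (fscale (of_real (real n)) g) + log_value g"
    using log_value_add[OF real_funs_scale[OF g] g] by metis
  then show ?case using Suc by (simp add: algebra_simps)
qed

text \<open>
  The value at \<open>exp (g + \<i> g)\<close> is attained at one point; its modulus and its argument then
  force the same value of \<open>g\<close>.
\<close>

lemma exp_imaginary_value:
  assumes g: "g \<in> real_funs"
  shows "\<phi> (lift exp (fscale \<i> g)) = exp (\<i> * of_real (log_value g))"
proof -
  have gA: "g \<in> funs A" "fscale \<i> g \<in> funs A"
    using g by (auto simp: real_funs_mem scale_mem)
  obtain x where x: "x \<in> points A" "\<phi> (lift exp (g + fscale \<i> g)) = lift exp (g + fscale \<i> g) x"
    using value_attained[OF exp_mem[OF add_mem[OF gA]]] .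
  \<comment> \<open>This second point only shows that the value has modulus one; it may differ from
    \<open>x\<close>.\<close>
  obtain y where y: "y \<in> points A" "\<phi> (lift exp (fscale \<i> g)) = lift exp (fscale \<i> g) y"
    using value_attained[OF exp_mem[OF gA(2)]] .
  have re: "g z = of_real (Re (g z))" for z using real_funs_Re[OF g] .
  have nz: "cmod (exp (\<i> * g z)) = 1" for z
    by (subst re) simp
  then have ny: "cmod (\<phi> (lift exp (fscale \<i> g))) = 1"
    using y by (simp add: lift_apply fscale_def)
  have e: "exp (of_real (log_value g)) * \<phi> (lift exp (fscale \<i> g)) = exp (g x) * exp (\<i> * g x)"
    using exp_value_add[OF gA] x exp_value[OF g] by (simp add: lift_apply fscale_def exp_add)
  from arg_cong[OF this, of cmod] have "exp (log_value g) = exp (Re (g x))"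
    using ny nz[of x] by (simp add: norm_mult)
  then have "g x = of_real (log_value g)" using re[of x] by simp
  with e show ?thesis by simp
qed

lemma log_value_attained:
  assumes g: "g \<in> real_funs"
  obtains x where "x \<in> points A" "g x = of_real (log_value g)"
proof -
  obtain x where x: "x \<in> points A" "\<phi> (lift exp g) = lift exp g x"
    using value_attained[OF exp_mem[OF real_funs_mem[OF g]]] .
  then have "exp (complex_of_real (Re (g x))) = exp (of_real (log_value g))"
    using exp_value[OF g] real_funs_Re[OF g, of x] by (simp add: lift_apply)
  then have "Re (g x) = log_value g" by (simp only: exp_of_real of_real_eq_iff exp_inj_iff)
  then show ?thesis using that[of x] x real_funs_Re[OF g, of x] by simp
qed

text \<open>Scaling \<open>g\<close> down removes the ambiguity of \<open>2 \<pi> \<i>\<close> in the logarithm.\<close>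

lemma log_value_jointly_attained:
  assumes f: "f \<in> real_funs" and g: "g \<in> real_funs"
  obtains x where "x \<in> points A" "f x = of_real (log_value f)" "g x = of_real (log_value g)"
proof -
  obtain R where R: "R > 0" "\<And>x. x \<in> points A \<Longrightarrow> cmod (g x) \<le> R"
    using bounded_image[OF real_funs_mem[OF g]] by blast
  \<comment> \<open>With \<open>n > R\<close> the scaled function \<open>h\<close> has absolute
    value below \<open>1\<close>. A natural number is taken so that
    \<open>log_value_scale_of_nat\<close> leads back to \<open>g\<close>.\<close>
  obtain n where n: "real n > R" using reals_Archimedean2 by blast
  then have n0: "real n > 0" using R by linarith
  define h where "h = fscale (of_real (1 / real n)) g"
  have h: "h \<in> real_funs" unfolding h_def by (rule real_funs_scale[OF g])
  have gh: "g = fscale (of_real (real n)) h" using n0 by (auto simp: h_def fscale_def fun_eq_iff)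
  have Lg: "log_value g = real n * log_value h"
    using arg_cong[OF gh, of log_value] log_value_scale_of_nat[OF h, of n] by (rule trans)
  have small: "\<bar>Re (h x)\<bar> < 1" if "x \<in> points A" for x
  proof -
    have "\<bar>Re (g x)\<bar> < real n" using R(2)[OF that] n abs_Re_le_cmod[of "g x"] by linarith
    then show ?thesis using n0 by (simp add: h_def fscale_def divide_simps)
  qed
  \<comment> \<open>\<open>log_value h\<close> is itself a value of \<open>h\<close>, so it obeys
    the same bound; two such numbers differ by less than \<open>2 < 2 * pi\<close>.\<close>
  obtain y where "y \<in> points A" "h y = of_real (log_value h)"
    using log_value_attained[OF h] .
  then have smallL: "\<bar>log_value h\<bar> < 1" using small[of y] by simp
  have m: "f \<in> funs A" "fscale \<i> h \<in> funs A"
    using f h by (auto simp: real_funs_mem scale_mem)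
  obtain x where x: "x \<in> points A" "\<phi> (lift exp (f + fscale \<i> h)) = lift exp (f + fscale \<i> h) x"
    using value_attained[OF exp_mem[OF add_mem[OF m]]] .
  obtain u v where uv: "f x = of_real u" "h x = of_real v"
    using real_funs_Re[OF f, of x] real_funs_Re[OF h, of x] by blast
  have "exp (f x + \<i> * h x) = exp (of_real (log_value f) + \<i> * of_real (log_value h))"
    using exp_value_add[OF m] x exp_value[OF f] exp_imaginary_value[OF h]
    by (simp add: lift_apply fscale_def exp_add)
  moreover have "\<bar>v\<bar> < 1" using small[OF x(1)] uv(2) by simp
  then have "\<bar>v - log_value h\<bar> < 2 * pi" using smallL pi_gt3 by linarith
  then have "\<bar>Im (f x + \<i> * h x) - Im (of_real (log_value f) + \<i> * of_real (log_value h))\<bar> < 2 * pi"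
    by (simp add: uv)
  ultimately have "f x + \<i> * h x = of_real (log_value f) + \<i> * of_real (log_value h)"
    by (rule exp_complex_eqI[rotated])
  then have "complex_of_real u + \<i> * of_real v = of_real (log_value f) + \<i> * of_real (log_value h)"
    unfolding uv .
  then have "u = log_value f" "v = log_value h" by (simp_all add: complex_eq_iff)
  moreover have "g x = of_real (real n) * h x" using n0 by (simp add: h_def fscale_def)
  ultimately show ?thesis using that[of x] x(1) uv Lg by simp
qed

text \<open>In a joint value of \<open>g\<close> and \<open>g * g\<close> the second entry is the
  square of the first.\<close>

lemma log_value_square:
  assumes g: "g \<in> real_funs"
  shows "log_value (g * g) = log_value g * log_value g"
proof -
  obtain x where "g x = of_real (log_value g)" "(g * g) x = of_real (log_value (g * g))"
    using log_value_jointly_attained[OF g real_funs_mult[OF g g]] .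
  then have "complex_of_real (log_value (g * g)) = of_real (log_value g * log_value g)" by simp
  then show ?thesis by (simp only: of_real_eq_iff)
qed

text \<open>For finitely many \<open>g\<close>, the sum of the squares of
  \<open>g - log_value g\<close> has \<open>log_value\<close> zero, by additivity and
  \<open>log_value_square\<close>. This value is attained, and a vanishing sum of real squares
  forces every summand to vanish there. Compactness passes to all real elements.\<close>

lemma log_value_point:
  obtains x where "x \<in> points A" "\<And>g. g \<in> real_funs \<Longrightarrow> g x = of_real (log_value g)"
proof (rule common_point[where F = real_funs and c = "\<lambda>g. of_real (log_value g)"])
  fix G :: "('a \<Rightarrow> complex) set" assume G: "finite G" "G \<subseteq> real_funs"
  define d where "d g = g + fscale (of_real (- log_value g)) (unit_fun A)" for g
  have d: "d g \<in> real_funs" if "g \<in> G" for g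
    using that G unfolding d_def by (intro real_funs_add real_funs_const) auto
  have "log_value (d g * d g) = 0" if "g \<in> G" for g
  proof -
    have "log_value (d g) = 0"
      unfolding d_def using that G
      by (subst log_value_add[OF _ real_funs_const]) (auto simp only: log_value_const right_minus)
    then show ?thesis using log_value_square[OF d[OF that]] by simp
  qed
  then have "log_value (\<Sum>g\<in>G. d g * d g) = 0"
    using log_value_sum[of G "\<lambda>g. d g * d g"] d real_funs_mult by simp
  moreover have "(\<Sum>g\<in>G. d g * d g) \<in> real_funs" by (intro real_funs_sum real_funs_mult d)
  from log_value_attained[OF this] obtain x
    where "x \<in> points A" "(\<Sum>g\<in>G. d g * d g) x = of_real (log_value (\<Sum>g\<in>G. d g * d g))" .
  ultimately have x: "x \<in> points A" "(\<Sum>g\<in>G. d g * d g) x = 0" by simp_all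
  have "complex_of_real (\<Sum>g\<in>G. (Re (d g x))\<^sup>2) = (\<Sum>g\<in>G. d g * d g) x"
    unfolding sum_fun_apply of_real_sum
  proof (rule sum.cong[OF refl])
    fix g assume "g \<in> G"
    have "of_real (Re (d g x)) = d g x" using real_funs_Re[OF d[OF \<open>g \<in> G\<close>], of x] by (rule sym)
    then show "complex_of_real ((Re (d g x))\<^sup>2) = (d g * d g) x"
      by (simp add: power2_eq_square)
  qed
  with x have "(\<Sum>g\<in>G. (Re (d g x))\<^sup>2) = 0" by (simp only: of_real_eq_0_iff)
  then have "d g x = 0" if "g \<in> G" for g
    using that G(1) by (subst real_funs_Re[OF d[OF that]]) (simp add: sum_nonneg_eq_0_iff)
  then have "\<forall>g\<in>G. g x = of_real (log_value g)"
    using x(1) by (simp add: d_def const_apply)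
  with x(1) show "\<exists>x\<in>points A. \<forall>g\<in>G. g x = of_real (log_value g)" by blast
next
  show "real_funs \<subseteq> funs A" using real_funs_mem by blast
qed (rule that)

section \<open>Common zeros of the kernel and the equivalences\<close>

text \<open>The meeting point of the argument: continuity and the span condition each produce such a
  point, and at such a point \<open>\<phi>\<close> is the evaluation.\<close>

definition vanishes_on_kernel :: "'a \<Rightarrow> bool" where
  "vanishes_on_kernel x \<longleftrightarrow> x \<in> points A \<and> (\<forall>f\<in>alg_ker A \<phi>. f x = 0)"

text \<open>
  Multiplying by a cutoff at \<open>x\<close>, on which \<open>\<phi>\<close> cannot vanish, shows that \<open>\<phi> f\<close> depends only on
  the germ of \<open>f\<close> at \<open>x\<close>; so \<open>f\<close> may be replaced by a function with values near \<open>f x\<close>.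
\<close>

lemma evaluation_of_vanishes_on_kernel:
  assumes x: "vanishes_on_kernel x" and f: "f \<in> funs A"
  shows "\<phi> f = f x"
proof -
  have xA: "x \<in> points A" using x by (simp add: vanishes_on_kernel_def)
  have "dist (\<phi> f) (f x) \<le> e" if e: "e > 0" for e
  proof -
    \<comment> \<open>\<open>p\<close> is the nearest-point projection onto the closed disc of
      radius \<open>e\<close> around \<open>f x\<close>, which is 1-Lipschitz. The cutoff
      \<open>w\<close> is positive at the centre and zero outside the disc, so
      \<open>w z * z = w z * p z\<close> for all \<open>z\<close>.\<close>
    define p where "p = closest_point (cball (f x) e)"
    define w where "w z = complex_of_real (max 0 (e - dist (f x) z))" for z
    have p: "lift p f \<in> funs A"
      by (rule lift_mem[OF f, of 1])
        (use e in \<open>auto intro!: lipschitz_onI closest_point_lipschitz simp: p_def\<close>)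
    have w: "lift w f \<in> funs A"
    proof (rule lift_mem[OF f, of 1], rule lipschitz_onI)
      fix u v
      have "\<bar>dist (f x) u - dist (f x) v\<bar> \<le> dist u v" by metric
      then show "dist (w u) (w v) \<le> 1 * dist u v"
        by (simp add: w_def dist_norm flip: of_real_diff)
    qed auto
    have "lift w f x \<noteq> 0" using e xA by (simp add: lift_apply w_def)
    \<comment> \<open>Otherwise \<open>lift w f\<close> would lie in the kernel and hence vanish at
      \<open>x\<close>.\<close>
    then have nz: "\<phi> (lift w f) \<noteq> 0"
      using x w by (auto simp: vanishes_on_kernel_def alg_ker_def)
    have "w z * z = w z * p z" for z
      by (cases "z \<in> cball (f x) e") (auto simp: w_def p_def closest_point_self)
    then have "lift w f * f = lift w f * lift p f"
      by (auto simp: lift_def fun_eq_iff)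
    then have "\<phi> (lift w f) * \<phi> f = \<phi> (lift w f) * \<phi> (lift p f)"
      using mult[OF w f] mult[OF w p] by metis
    then have "\<phi> f = \<phi> (lift p f)" using nz by simp
    moreover obtain y where "y \<in> points A" "\<phi> (lift p f) = lift p f y"
      using value_attained[OF p] .
    moreover have "p (f y) \<in> cball (f x) e"
      unfolding p_def by (rule closest_point_in_set) (use e in auto)
    ultimately show ?thesis by (simp add: lift_apply dist_commute)
  qed
  then have "dist (\<phi> f) (f x) \<le> 0" by (meson dense_ge)
  then show ?thesis by simp
qed

lemma character_of_vanishes_on_kernel:
  assumes "vanishes_on_kernel x"
  shows "character A \<phi>"
proof -
  note eval = evaluation_of_vanishes_on_kernel[OF assms]
  have "complex_linear A \<phi>"
    unfolding complex_linear_def by (auto simp: eval add_mem scale_mem) (simp add: fscale_def)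
  moreover have "\<exists>f\<in>funs A. \<phi> f \<noteq> 0"
    using unit_mem unit_value by (intro bexI[of _ "unit_fun A"]) auto
  ultimately show ?thesis using multiplicative by (simp add: character_def)
qed

text \<open>Linearity turns \<open>\<phi> g - \<phi> f\<close> into a value of \<open>g - f\<close>,
  which the norm dominates; so \<open>\<phi>\<close> is nonexpansive.\<close>

lemma norm_continuous_of_character:
  assumes "character A \<phi>"
  shows "norm_continuous A \<phi>"
  unfolding norm_continuous_def
proof (intro ballI allI impI)
  fix f and \<epsilon> :: real assume f: "f \<in> funs A" and \<epsilon>: "\<epsilon> > 0"
  have "cmod (\<phi> g - \<phi> f) \<le> alg_norm A (g - f)" if g: "g \<in> funs A" for g
  proof -
    have "\<phi> ((g - f) + f) = \<phi> (g - f) + \<phi> f"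
      using assms f diff_mem[OF g f] unfolding character_def complex_linear_def by blast
    then have "\<phi> g - \<phi> f = \<phi> (g - f)" by simp
    moreover obtain x where "x \<in> points A" "\<phi> (g - f) = (g - f) x"
      using value_attained[OF diff_mem[OF g f]] .
    ultimately show ?thesis using norm_ge[OF diff_mem[OF g f]] by metis
  qed
  then show "\<exists>\<delta>>0. \<forall>g\<in>funs A. alg_norm A (g - f) < \<delta> \<longrightarrow> cmod (\<phi> g - \<phi> f) < \<epsilon>"
    using \<epsilon> by (meson le_less_trans)
qed

text \<open>For \<open>f\<close> in the kernel, multiplicativity gives \<open>\<phi> q = 0\<close>
  for \<open>q = |f|^2\<close>. For \<open>c > 0\<close> the function \<open>q + c\<close> is the
  exponential of a real element, so \<open>\<phi>\<close> evaluates it at the point of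
  \<open>log_value_point\<close>, which is the same for all \<open>f\<close>. Letting
  \<open>c\<close> tend to \<open>0\<close>, continuity forces \<open>|f x|^2 = 0\<close>.\<close>

lemma vanishes_on_kernel_of_norm_continuous:
  assumes "norm_continuous A \<phi>"
  obtains x where "vanishes_on_kernel x"
proof -
  obtain x where x: "x \<in> points A" "\<And>g. g \<in> real_funs \<Longrightarrow> g x = of_real (log_value g)"
    using log_value_point by blast
  have "f x = 0" if f: "f \<in> alg_ker A \<phi>" for f
  proof -
    have fA: "f \<in> funs A" and f0: "\<phi> f = 0" using f by (auto simp: alg_ker_def)
    define q where "q = f * lift cnj f"
    have q: "q \<in> funs A" unfolding q_def by (intro mult_mem fA cnj_mem)
    have qy: "q y = of_real ((cmod (f y))\<^sup>2)" if "y \<in> points A" for y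
      using that by (simp add: q_def lift_apply complex_norm_square del: of_real_power)
    have q0: "\<phi> q = 0" unfolding q_def using mult[OF fA cnj_mem[OF fA]] f0 by simp
    have "(cmod (f x))\<^sup>2 \<le> \<epsilon>" if \<epsilon>: "\<epsilon> > 0" for \<epsilon>
    proof -
      obtain \<delta> where \<delta>: "\<delta> > 0" "\<And>g. g \<in> funs A \<Longrightarrow> alg_norm A (g - q) < \<delta> \<Longrightarrow> cmod (\<phi> g - \<phi> q) < \<epsilon>"
        using assms q \<epsilon> unfolding norm_continuous_def by metis
      \<comment> \<open>Adding this constant moves \<open>q\<close> by less than
        \<open>\<delta>\<close> in norm while keeping the values at least \<open>c > 0\<close>, as
        the logarithm requires.\<close>
      define c where "c = \<delta> / 2"
      have c: "c > 0" "c < \<delta>" using \<delta> by (auto simp: c_def)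
      define r where "r = q + fscale (of_real c) (unit_fun A)"
      have r: "r \<in> funs A" unfolding r_def by (intro add_mem q const_mem)
      have ry: "r y = of_real ((cmod (f y))\<^sup>2 + c)" if "y \<in> points A" for y
        using that by (simp add: r_def qy const_apply)
      have "alg_norm A (r - q) \<le> cmod (of_real c)"
        using norm_const[OF nonempty, of "of_real c"] by (simp add: r_def)
      then have small: "cmod (\<phi> r) < \<epsilon>" using \<delta>(2)[OF r] c q0 by simp
      define l where "l = lift (\<lambda>z. of_real (ln (Re z))) r"
      have l: "l \<in> real_funs"
        unfolding real_funs_def l_def
        by (auto intro!: log_mem[OF r c(1)] simp: ry) (simp add: lift_def)
      have "lift exp l = r"
        by (rule lift_eqI) (use c in \<open>auto simp: l_def lift_apply ry vanish[OF r] exp_of_real add_nonneg_pos\<close>)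
      then have "\<phi> r = exp (l x)" using exp_value[OF l] x(2)[OF l] by simp
      also have "\<dots> = r x" using \<open>lift exp l = r\<close> x(1) lift_apply by metis
      finally have "cmod (\<phi> r) = (cmod (f x))\<^sup>2 + c"
        using ry[OF x(1)] c by (simp only: norm_of_real) simp
      then show ?thesis using small c by linarith
    qed
    then have "(cmod (f x))\<^sup>2 \<le> 0" by (meson dense_ge)
    then show ?thesis by simp
  qed
  with x(1) have "vanishes_on_kernel x" by (simp add: vanishes_on_kernel_def)
  then show ?thesis by (rule that)
qed

text \<open>The kernel of a linear \<open>\<phi>\<close> is a subspace, so taking the span adds
  nothing to it.\<close>

lemma unit_notin_span_of_character:
  assumes "character A \<phi>"
  shows "unit_fun A \<notin> cspan (alg_ker A \<phi>)"
proof -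
  interpret vector_space fscale by (rule vector_space_fscale)
  have "subspace (alg_ker A \<phi>)"
  proof (rule subspaceI)
    show "0 \<in> alg_ker A \<phi>"
      using value_attained[OF zero_mem] by (auto simp: alg_ker_def zero_mem)
  qed (use assms in \<open>auto simp: alg_ker_def character_def complex_linear_def add_mem scale_mem\<close>)
  then have "cspan (alg_ker A \<phi>) = alg_ker A \<phi>" by (simp only: span_eq_iff)
  moreover have "unit_fun A \<notin> alg_ker A \<phi>" by (simp add: alg_ker_def unit_value)
  ultimately show ?thesis by metis
qed

text \<open>If finitely many kernel elements had no common zero, the sum \<open>s\<close> of their
  \<open>|f|^2\<close> would have an inverse \<open>k\<close>. Multiplicativity keeps each
  \<open>f * (lift cnj f * k)\<close> in the kernel, so \<open>s * k\<close> exhibits the unit as a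
  sum of kernel elements. Compactness then yields a zero common to all of the kernel.\<close>

lemma vanishes_on_kernel_of_unit_notin_span:
  assumes "unit_fun A \<notin> cspan (alg_ker A \<phi>)"
  obtains x where "vanishes_on_kernel x"
proof (rule common_point[where F = "alg_ker A \<phi>" and c = "\<lambda>_. 0"])
  interpret vector_space fscale by (rule vector_space_fscale)
  fix G assume G: "finite G" "G \<subseteq> alg_ker A \<phi>"
  have GA: "f \<in> funs A" "\<phi> f = 0" if "f \<in> G" for f
    using that G by (auto simp: alg_ker_def)
  show "\<exists>x\<in>points A. \<forall>f\<in>G. f x = 0"
  proof (rule ccontr)
    assume contra: "\<not> ?thesis"
    define s where "s = (\<Sum>f\<in>G. f * lift cnj f)"
    have s: "s \<in> funs A" unfolding s_def using GA by (intro sum_mem mult_mem cnj_mem) auto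
    have sx: "s x = of_real (\<Sum>f\<in>G. (cmod (f x))\<^sup>2)" if "x \<in> points A" for x
      using that by (simp add: s_def sum_fun_apply lift_apply complex_norm_square del: of_real_power)
    have nz: "s x \<noteq> 0" if x: "x \<in> points A" for x
    proof
      assume "s x = 0"
      then have "(\<Sum>f\<in>G. (cmod (f x))\<^sup>2) = 0" using sx[OF x] by (simp only: of_real_eq_0_iff)
      then have "\<forall>f\<in>G. f x = 0" using G(1) by (simp add: sum_nonneg_eq_0_iff)
      then show False using contra x by blast
    qed
    define k where "k = lift inverse s"
    have k: "k \<in> funs A" unfolding k_def by (rule inverse_mem[OF s nz])
    have "unit_fun A = s * k"
      by (rule funs_eqI[OF unit_mem mult_mem[OF s k]])
        (use nz in \<open>simp add: k_def lift_apply unit_apply\<close>)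
    also have "\<dots> = (\<Sum>f\<in>G. f * (lift cnj f * k))"
      by (simp add: s_def sum_distrib_right mult.assoc)
    also have "\<dots> \<in> cspan (alg_ker A \<phi>)"
    proof (intro span_sum span_base)
      fix f assume f: "f \<in> G"
      have "lift cnj f * k \<in> funs A" by (intro mult_mem cnj_mem GA f k)
      then show "f * (lift cnj f * k) \<in> alg_ker A \<phi>"
        using GA[OF f] by (simp add: alg_ker_def mult_mem mult)
    qed
    finally show False using assms by simp
  qed
next
  fix x assume "x \<in> points A" "\<And>f. f \<in> alg_ker A \<phi> \<Longrightarrow> f x = 0"
  then have "vanishes_on_kernel x" by (simp add: vanishes_on_kernel_def)
  then show thesis by (rule that)
qed (auto simp: alg_ker_def)

theorem character_equivalences:
  "(character A \<phi> \<longleftrightarrow> norm_continuous A \<phi>) \<and>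
   (norm_continuous A \<phi> \<longleftrightarrow> unit_fun A \<notin> cspan (alg_ker A \<phi>))"
  using character_of_vanishes_on_kernel norm_continuous_of_character unit_notin_span_of_character
    vanishes_on_kernel_of_norm_continuous vanishes_on_kernel_of_unit_notin_span
  by metis

end

section \<open>The algebra of continuous functions\<close>

lemma sup_norm_ge:
  assumes "bounded (f ` S)" "x \<in> S"
  shows "cmod (f x) \<le> sup_norm S f"
  unfolding sup_norm_def using assms
  by (intro cSUP_upper) (auto simp: bounded_iff intro: bdd_aboveI2)

lemma sup_norm_const: "S \<noteq> {} \<Longrightarrow> sup_norm S (fscale c (indicator S)) = cmod c"
  by (simp add: sup_norm_def fscale_def)

lemma bounded_continuous_map_image:
  fixes f :: "'a \<Rightarrow> complex"
  assumes "compact_space X" "continuous_map X euclidean f"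
  shows "bounded (f ` topspace X)"
  using assms by (metis compact_imp_bounded compactin_euclidean_iff compact_space_def image_compactin)

lemma lipschitz_algebra_C_alg:
  assumes X: "compact_space X"
  shows "lipschitz_algebra (C_alg X) X"
proof
  fix f h :: "_ \<Rightarrow> complex" and L
  assume f: "f \<in> funs (C_alg X)" and h: "L-lipschitz_on (f ` points (C_alg X)) h"
  let ?S = "topspace X"
  \<comment> \<open>\<open>h\<close> is known to be continuous only on the range of
    \<open>f\<close>, so \<open>f\<close> is regarded as a map into that range.\<close>
  have f': "continuous_map X (top_of_set (f ` ?S)) f"
    using f by (auto simp: C_alg_def continuous_map_in_subtopology)
  have "continuous_map (top_of_set (f ` ?S)) euclidean h"
    using lipschitz_on_continuous_on[OF h] by (simp add: C_alg_def)
  with f' have "continuous_map X euclidean (h \<circ> f)" by (rule continuous_map_compose)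
  then have "continuous_map X euclidean (\<lambda>x. if x \<in> ?S then h (f x) else 0)"
    by (rule continuous_map_eq) simp
  then show "(\<lambda>x. if x \<in> points (C_alg X) then h (f x) else 0) \<in> funs (C_alg X)"
    by (simp add: C_alg_def)
next
  fix f g assume "f \<in> funs (C_alg X)" "g \<in> funs (C_alg X)"
  then show "f + g \<in> funs (C_alg X)"
    by (auto simp: C_alg_def plus_fun_def intro!: continuous_intros)
next
  fix f x assume "f \<in> funs (C_alg X)" "x \<in> points (C_alg X)"
  then show "cmod (f x) \<le> alg_norm (C_alg X) f"
    by (simp add: C_alg_def sup_norm_ge bounded_continuous_map_image[OF X])
qed (use X in \<open>auto simp: C_alg_def sup_norm_const unit_fun_def zero_fun_def\<close>)

section \<open>The algebra of Lipschitz functions\<close>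

lemma funs_Lip_alg:
  "funs (Lip_alg m) = {f. (\<exists>B. \<forall>x\<in>mspace m. \<forall>y\<in>mspace m. dist (f x) (f y) \<le> B * mdist m x y) \<and>
     (\<forall>x. x \<notin> mspace m \<longrightarrow> f x = 0)}"
  by (simp add: Lip_alg_def Lipschitz_continuous_map_def)

lemma lip_const_nonneg:
  assumes "f \<in> funs (Lip_alg m)"
  shows "0 \<le> lip_const m f"
proof -
  \<comment> \<open>The bound \<open>B\<close> shows that the infimum is taken over a nonempty set,
    so the lower bound \<open>0\<close> of the set passes to it.\<close>
  obtain B where "B > 0" "\<forall>x\<in>mspace m. \<forall>y\<in>mspace m. dist (f x) (f y) \<le> B * mdist m x y"
    using assms by (auto simp: Lip_alg_def Lipschitz_continuous_map_pos)
  then show ?thesis unfolding lip_const_def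
    by (intro cInf_greatest) (auto intro!: exI[of _ B])
qed

lemma lipschitz_algebra_Lip_alg:
  assumes m: "compact_space (mtopology_of m)"
  shows "lipschitz_algebra (Lip_alg m) (mtopology_of m)"
proof
  show cont: "continuous_map (mtopology_of m) euclidean f" if "f \<in> funs (Lip_alg m)" for f
    using that Lipschitz_continuous_imp_continuous_map[of m euclidean_metric f]
    by (simp add: Lip_alg_def)
  show "cmod (f x) \<le> alg_norm (Lip_alg m) f"
    if f: "f \<in> funs (Lip_alg m)" and x: "x \<in> points (Lip_alg m)" for f x
  proof -
    have "cmod (f x) \<le> sup_norm (mspace m) f"
      using bounded_continuous_map_image[OF m cont[OF f]] x by (simp add: Lip_alg_def sup_norm_ge)
    then show ?thesis using lip_const_nonneg[OF f] by (simp add: Lip_alg_def)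
  qed
next
  fix f h :: "_ \<Rightarrow> complex" and L
  assume f: "f \<in> funs (Lip_alg m)" and h: "L-lipschitz_on (f ` points (Lip_alg m)) h"
  obtain B where B: "\<And>x y. x \<in> mspace m \<Longrightarrow> y \<in> mspace m \<Longrightarrow> dist (f x) (f y) \<le> B * mdist m x y"
    using f by (auto simp: funs_Lip_alg)
  have "dist (h (f x)) (h (f y)) \<le> (L * B) * mdist m x y" if "x \<in> mspace m" "y \<in> mspace m" for x y
  proof -
    have "dist (h (f x)) (h (f y)) \<le> L * dist (f x) (f y)"
      using lipschitz_onD[OF h] that by (simp add: Lip_alg_def)
    also have "\<dots> \<le> L * (B * mdist m x y)"
      using B[OF that] lipschitz_on_nonneg[OF h] by (rule mult_left_mono)
    finally show ?thesis by simp
  qed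
  then have "\<exists>B. \<forall>x\<in>mspace m. \<forall>y\<in>mspace m. dist (h (f x)) (h (f y)) \<le> B * mdist m x y" by blast
  then show "(\<lambda>x. if x \<in> points (Lip_alg m) then h (f x) else 0) \<in> funs (Lip_alg m)"
    by (simp add: funs_Lip_alg) (simp add: Lip_alg_def)
next
  fix f g :: "_ \<Rightarrow> complex" assume f: "f \<in> funs (Lip_alg m)" and g: "g \<in> funs (Lip_alg m)"
  obtain B where B: "\<And>x y. x \<in> mspace m \<Longrightarrow> y \<in> mspace m \<Longrightarrow> dist (f x) (f y) \<le> B * mdist m x y"
    using f by (auto simp: funs_Lip_alg)
  obtain C where C: "\<And>x y. x \<in> mspace m \<Longrightarrow> y \<in> mspace m \<Longrightarrow> dist (g x) (g y) \<le> C * mdist m x y"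
    using g by (auto simp: funs_Lip_alg)
  have "dist (f x + g x) (f y + g y) \<le> (B + C) * mdist m x y"
    if "x \<in> mspace m" "y \<in> mspace m" for x y
    using dist_triangle_add[of "f x" "g x" "f y" "g y"] B[OF that] C[OF that]
    by (simp add: distrib_right)
  then show "f + g \<in> funs (Lip_alg m)" using f g by (auto simp: funs_Lip_alg)
next
  fix c assume ne: "points (Lip_alg m) \<noteq> {}"
  \<comment> \<open>The function is constant on the space, so \<open>0\<close> is an admissible
    Lipschitz constant.\<close>
  have "lip_const m (fscale c (indicator (mspace m))) \<le> 0"
    unfolding lip_const_def by (rule cInf_lower) (auto simp: fscale_def intro: bdd_belowI)
  then show "alg_norm (Lip_alg m) (fscale c (unit_fun (Lip_alg m))) \<le> cmod c"
    using ne by (simp add: Lip_alg_def unit_fun_def sup_norm_const)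
qed (use m in \<open>auto simp: funs_Lip_alg intro: exI[of _ 0]\<close>, auto simp: Lip_alg_def)

section \<open>Absolute continuity, bounded variation and the algebra on the unit interval\<close>

text \<open>Elements of a division are nonempty compact intervals. Expressing their length by
  \<open>measure lborel\<close> gives access to the additivity of content over divisions.\<close>

lemma division_interval:
  fixes d :: "real set set"
  assumes "d division_of t" "k \<in> d"
  shows "Inf k \<in> k" "Sup k \<in> k" "Inf k \<le> Sup k" "k = {Inf k..Sup k}" "measure lborel k = Sup k - Inf k" "k \<subseteq> t"
proof -
  obtain a b where "k = {a..b}" "a \<le> b"
    using division_ofD(3,4)[OF assms] by (metis atLeastatMost_empty_iff2 box_real(2))
  then show "Inf k \<in> k" "Sup k \<in> k" "Inf k \<le> Sup k" "k = {Inf k..Sup k}" "measure lborel k = Sup k - Inf k"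
    by auto
qed (use division_ofD(2)[OF assms] in blast)

lemma increment_sum_nonneg: "0 \<le> increment_sum f d"
  by (simp add: increment_sum_def sum_nonneg)

lemma increment_sum_add: "increment_sum (f + g) d \<le> increment_sum f d + increment_sum g d"
  unfolding increment_sum_def sum.distrib[symmetric]
proof (rule sum_mono)
  fix k
  show "cmod ((f + g) (Sup k) - (f + g) (Inf k))
      \<le> cmod (f (Sup k) - f (Inf k)) + cmod (g (Sup k) - g (Inf k))"
    using norm_triangle_ineq[of "f (Sup k) - f (Inf k)" "g (Sup k) - g (Inf k)"]
    by (simp add: algebra_simps)
qed

lemma absolutely_continuous_onE:
  assumes "absolutely_continuous_on S f" "\<epsilon> > 0"
  obtains \<delta> where "\<delta> > 0" "\<And>d t. d division_of t \<Longrightarrow> t \<subseteq> S \<Longrightarrow> (\<Sum>k\<in>d. Sup k - Inf k) < \<delta> \<Longrightarrow>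
    increment_sum f d < \<epsilon>"
  using assms unfolding absolutely_continuous_on_def by metis

lemma absolutely_continuous_on_add:
  assumes f: "absolutely_continuous_on S f" and g: "absolutely_continuous_on S g"
  shows "absolutely_continuous_on S (f + g)"
  unfolding absolutely_continuous_on_def
proof (intro allI impI)
  fix \<epsilon> :: real assume "\<epsilon> > 0"
  then have \<epsilon>: "\<epsilon> / 2 > 0" by simp
  obtain \<delta> where \<delta>: "\<delta> > 0" "\<And>d t. d division_of t \<Longrightarrow> t \<subseteq> S \<Longrightarrow> (\<Sum>k\<in>d. Sup k - Inf k) < \<delta> \<Longrightarrow>
    increment_sum f d < \<epsilon> / 2"
    using absolutely_continuous_onE[OF f \<epsilon>] by blast
  obtain \<delta>' where \<delta>': "\<delta>' > 0" "\<And>d t. d division_of t \<Longrightarrow> t \<subseteq> S \<Longrightarrow> (\<Sum>k\<in>d. Sup k - Inf k) < \<delta>' \<Longrightarrow>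
    increment_sum g d < \<epsilon> / 2"
    using absolutely_continuous_onE[OF g \<epsilon>] by blast
  show "\<exists>\<delta>>0. \<forall>d t. d division_of t \<and> t \<subseteq> S \<and> (\<Sum>k\<in>d. Sup k - Inf k) < \<delta> \<longrightarrow>
    increment_sum (f + g) d < \<epsilon>"
  proof (intro exI[of _ "min \<delta> \<delta>'"] conjI allI impI)
    fix d t assume *: "d division_of t \<and> t \<subseteq> S \<and> (\<Sum>k\<in>d. Sup k - Inf k) < min \<delta> \<delta>'"
    then have "increment_sum f d < \<epsilon> / 2" by (intro \<delta>(2)[of d t]) auto
    moreover have "increment_sum g d < \<epsilon> / 2" using * by (intro \<delta>'(2)[of d t]) auto
    ultimately show "increment_sum (f + g) d < \<epsilon>" using increment_sum_add[of f g d] by linarith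
  qed (use \<delta> \<delta>' in auto)
qed

lemma absolutely_continuous_on_lipschitz_compose:
  assumes f: "absolutely_continuous_on S f" and h: "L-lipschitz_on (f ` S) h"
    and g: "\<And>x. x \<in> S \<Longrightarrow> g x = h (f x)"
  shows "absolutely_continuous_on S g"
  unfolding absolutely_continuous_on_def
proof (intro allI impI)
  fix \<epsilon> :: real assume \<epsilon>: "\<epsilon> > 0"
  have L: "L \<ge> 0" using lipschitz_on_nonneg[OF h] .
  \<comment> \<open>\<open>L\<close> may be \<open>0\<close>; dividing by \<open>L + 1\<close>
    avoids a case distinction.\<close>
  have \<epsilon>': "\<epsilon> / (L + 1) > 0" using L \<epsilon> by simp
  obtain \<delta> where \<delta>: "\<delta> > 0" "\<And>d t. d division_of t \<Longrightarrow> t \<subseteq> S \<Longrightarrow> (\<Sum>k\<in>d. Sup k - Inf k) < \<delta> \<Longrightarrow>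
    increment_sum f d < \<epsilon> / (L + 1)"
    using absolutely_continuous_onE[OF f \<epsilon>'] by blast
  show "\<exists>\<delta>>0. \<forall>d t. d division_of t \<and> t \<subseteq> S \<and> (\<Sum>k\<in>d. Sup k - Inf k) < \<delta> \<longrightarrow>
    increment_sum g d < \<epsilon>"
  proof (intro exI[of _ \<delta>] conjI allI impI)
    fix d t assume *: "d division_of t \<and> t \<subseteq> S \<and> (\<Sum>k\<in>d. Sup k - Inf k) < \<delta>"
    have "increment_sum g d \<le> L * increment_sum f d"
      unfolding increment_sum_def sum_distrib_left
    proof (rule sum_mono)
      fix k assume "k \<in> d"
      then have "Sup k \<in> S" "Inf k \<in> S" using * division_interval(1,2,6)[of d t k] by auto
      then show "cmod (g (Sup k) - g (Inf k)) \<le> L * cmod (f (Sup k) - f (Inf k))"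
        using lipschitz_onD[OF h, of "f (Sup k)" "f (Inf k)"] by (simp add: g dist_norm)
    qed
    also have "\<dots> \<le> (L + 1) * increment_sum f d"
      by (intro mult_right_mono increment_sum_nonneg) simp
    also have "\<dots> < (L + 1) * (\<epsilon> / (L + 1))"
      using L * by (intro mult_strict_left_mono \<delta>(2)[of d t]) auto
    also have "\<dots> = \<epsilon>" using L by simp
    finally show "increment_sum g d < \<epsilon>" .
  qed (rule \<delta>(1))
qed

lemma absolutely_continuous_on_imp_continuous_on:
  assumes f: "absolutely_continuous_on {a..b} f"
  shows "continuous_on {a..b} f"
  unfolding continuous_on_iff
proof (intro ballI allI impI)
  fix x \<epsilon> :: real assume x: "x \<in> {a..b}" and \<epsilon>: "\<epsilon> > 0"
  obtain \<delta> where \<delta>: "\<delta> > 0" "\<And>d t. d division_of t \<Longrightarrow> t \<subseteq> {a..b} \<Longrightarrow> (\<Sum>k\<in>d. Sup k - Inf k) < \<delta> \<Longrightarrow>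
    increment_sum f d < \<epsilon>"
    using absolutely_continuous_onE[OF f \<epsilon>] by blast
  have *: "dist (f u) (f v) < \<epsilon>" if "u \<in> {a..b}" "v \<in> {a..b}" "u \<le> v" "v - u < \<delta>" for u v
  proof -
    \<comment> \<open>A single interval is already a division, and its increment sum is the distance
      between the two values.\<close>
    have "{{u..v}} division_of {u..v}" using division_of_self[of u v] that by simp
    from \<delta>(2)[OF this] that have "increment_sum f {{u..v}} < \<epsilon>" by simp
    then show ?thesis using that by (simp add: increment_sum_def dist_norm norm_minus_commute)
  qed
  have "dist (f x') (f x) < \<epsilon>" if "x' \<in> {a..b}" "dist x' x < \<delta>" for x'
    using *[of x x'] *[of x' x] that x
    by (cases "x \<le> x'") (auto simp: dist_real_def dist_commute)
  then show "\<exists>d>0. \<forall>x'\<in>{a..b}. dist x' x < d \<longrightarrow> dist (f x') (f x) < \<epsilon>" using \<delta>(1) by blast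
qed

text \<open>Makes the supremum in \<open>total_variation\<close> meaningful. In an arbitrary
  division, an interval of length at least \<open>\<eta>\<close> contributes at most
  \<open>2 * M\<close>, hence at most \<open>2 * M / \<eta>\<close> times its length, and the
  lengths add up to at most that of \<open>{a..b}\<close>. The shorter intervals are grouped by the
  grid cell of their left end; each group is short enough in total to contribute at most
  \<open>1\<close>, and the number of cells does not depend on the division.\<close>

lemma absolutely_continuous_on_bounded_variation:
  assumes f: "absolutely_continuous_on {a..b} f"
  shows "bdd_above (increment_sum f ` {d. d division_of {a..b}})"
proof -
  obtain M where M: "\<And>x. x \<in> {a..b} \<Longrightarrow> cmod (f x) \<le> M" "M > 0"
    using compact_continuous_image[OF absolutely_continuous_on_imp_continuous_on[OF f] compact_Icc]
    by (metis bounded_pos compact_imp_bounded imageI)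
  obtain \<delta> where \<delta>: "\<delta> > 0" "\<And>d t. d division_of t \<Longrightarrow> t \<subseteq> {a..b} \<Longrightarrow> (\<Sum>k\<in>d. Sup k - Inf k) < \<delta> \<Longrightarrow>
    increment_sum f d < 1"
    using absolutely_continuous_onE[OF f, of 1] by auto
  \<comment> \<open>A group of short intervals fits into a window of length
    \<open>2 * \<eta>\<close>, which has to stay below \<open>\<delta>\<close>.\<close>
  define \<eta> where "\<eta> = \<delta> / 3"
  have \<eta>: "\<eta> > 0" using \<delta> by (simp add: \<eta>_def)
  define cell where "cell k = \<lfloor>(Inf k - a) / \<eta>\<rfloor>" for k
  define J where "J = {0..\<lfloor>(b - a) / \<eta>\<rfloor>}"
  have "increment_sum f d \<le> 2 * M / \<eta> * measure lborel {a..b} + real (card J)" if d: "d division_of {a..b}" for d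
  proof -
    define long where "long = {k \<in> d. \<eta> \<le> Sup k - Inf k}"
    define short where "short = {k \<in> d. Sup k - Inf k < \<eta>}"
    have fin: "finite d" using d by blast
    have "increment_sum f long \<le> (\<Sum>k\<in>long. 2 * M / \<eta> * measure lborel k)"
      unfolding increment_sum_def
    proof (rule sum_mono)
      fix k assume "k \<in> long"
      then have k: "k \<in> d" "\<eta> \<le> measure lborel k" using division_interval(5)[OF d] by (auto simp: long_def)
      have "cmod (f (Sup k)) \<le> M" "cmod (f (Inf k)) \<le> M"
        using division_interval[OF d k(1)] M(1) by blast+
      then have "cmod (f (Sup k) - f (Inf k)) \<le> 2 * M"
        using norm_triangle_ineq4[of "f (Sup k)" "f (Inf k)"] by linarith
      also have "\<dots> = 2 * M / \<eta> * \<eta>" using \<eta> by simp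
      also have "\<dots> \<le> 2 * M / \<eta> * measure lborel k" using k \<eta> M by (intro mult_left_mono) auto
      finally show "cmod (f (Sup k) - f (Inf k)) \<le> 2 * M / \<eta> * measure lborel k" .
    qed
    also have "\<dots> \<le> (\<Sum>k\<in>d. 2 * M / \<eta> * measure lborel k)"
      using fin M \<eta> by (intro sum_mono2) (auto simp: long_def)
    also have "\<dots> = 2 * M / \<eta> * measure lborel {a..b}"
      using additive_content_division[of d a b] d by (metis box_real(2) sum_distrib_left)
    finally have 1: "increment_sum f long \<le> 2 * M / \<eta> * measure lborel {a..b}" .
    have grp: "increment_sum f {k \<in> short. cell k = j} \<le> 1" for j
    proof -
      define e where "e = {k \<in> short. cell k = j}"
      have ed: "e \<subseteq> d" by (auto simp: e_def short_def)
      have e: "e division_of \<Union>e"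
        by (rule division_of_subset[OF _ ed]) (use d in \<open>simp add: division_of_def\<close>)
      \<comment> \<open>Left ends lie in a cell of width \<open>\<eta>\<close> and the intervals are
        shorter than \<open>\<eta>\<close>, whence the factor \<open>2\<close>.\<close>
      have "\<Union>e \<subseteq> cbox (a + j * \<eta>) (a + j * \<eta> + 2 * \<eta>)"
      proof
        fix x assume "x \<in> \<Union>e"
        then obtain k where k: "k \<in> e" "x \<in> k" by blast
        then have x: "Inf k \<le> x" "x \<le> Sup k" using division_interval(4)[OF e k(1)] by auto
        have "j \<le> (Inf k - a) / \<eta>" "(Inf k - a) / \<eta> < j + 1" "Sup k - Inf k < \<eta>"
          using k(1) by (auto simp: e_def cell_def short_def)
        then have "j * \<eta> \<le> Inf k - a" "Inf k - a < j * \<eta> + \<eta>" "Sup k < Inf k + \<eta>"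
          using \<eta> by (simp_all add: field_simps)
        with x show "x \<in> cbox (a + j * \<eta>) (a + j * \<eta> + 2 * \<eta>)" by simp
      qed
      \<comment> \<open>The intervals have disjoint interiors, so their total length is at most that
        of the window.\<close>
      then have "sum (measure lborel) e \<le> measure lborel (cbox (a + j * \<eta>) (a + j * \<eta> + 2 * \<eta>))"
        by (rule subadditive_content_division[OF e])
      also have "\<dots> < \<delta>" using \<eta> by (simp add: \<eta>_def)
      finally have "(\<Sum>k\<in>e. Sup k - Inf k) < \<delta>"
        using division_interval(5)[OF e] by simp
      moreover have "\<Union>e \<subseteq> {a..b}" using ed division_ofD(2)[OF d] by blast
      ultimately show ?thesis using \<delta>(2)[OF e] unfolding e_def by fastforce
    qed
    have "cell ` short \<subseteq> J"
    proof
      fix j assume "j \<in> cell ` short"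
      then obtain k where k: "k \<in> d" "j = cell k" by (auto simp: short_def)
      then have "Inf k \<in> {a..b}" using division_interval[OF d k(1)] by blast
      then show "j \<in> J" using \<eta> k(2)
        by (auto simp: J_def cell_def intro!: floor_mono divide_right_mono)
    qed
    then have card: "card (cell ` short) \<le> card J" by (intro card_mono) (auto simp: J_def)
    have "increment_sum f short = (\<Sum>j\<in>cell ` short. increment_sum f {k \<in> short. cell k = j})"
      unfolding increment_sum_def by (rule sum.image_gen) (use fin in \<open>simp add: short_def\<close>)
    also have "\<dots> \<le> (\<Sum>j\<in>cell ` short. 1)" by (rule sum_mono) (rule grp)
    also have "\<dots> \<le> card J" using card by simp
    finally have 2: "increment_sum f short \<le> card J" .
    have ls: "d = long \<union> short" "long \<inter> short = {}" by (auto simp: long_def short_def)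
    then have "finite long" "finite short" using fin by auto
    then have "increment_sum f d = increment_sum f long + increment_sum f short"
      unfolding increment_sum_def ls(1) using ls(2) by (rule sum.union_disjoint)
    with 1 2 show ?thesis by linarith
  qed
  then show ?thesis by (intro bdd_aboveI2) auto
qed

lemma total_variation_nonneg:
  assumes "absolutely_continuous_on {a..b} f" "a \<le> b"
  shows "0 \<le> total_variation a b f"
proof -
  have "{{a..b}} division_of {a..b}" using division_of_self[of a b] assms(2) by simp
  then have "increment_sum f {{a..b}} \<le> total_variation a b f"
    unfolding total_variation_def
    by (intro cSUP_upper absolutely_continuous_on_bounded_variation[OF assms(1)]) auto
  then show ?thesis using increment_sum_nonneg order_trans by blast
qed

lemma total_variation_const:
  assumes "a \<le> b"
  shows "total_variation a b (fscale c (indicator {a..b})) = 0"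
proof -
  have "increment_sum (fscale c (indicator {a..b})) d = 0" if d: "d division_of {a..b}" for d
    unfolding increment_sum_def
  proof (rule sum.neutral, rule ballI)
    fix k assume "k \<in> d"
    then have "Sup k \<in> {a..b}" "Inf k \<in> {a..b}" using division_interval[OF d] by blast+
    then show "cmod (fscale c (indicator {a..b}) (Sup k) - fscale c (indicator {a..b}) (Inf k)) = 0"
      by (simp add: fscale_def)
  qed
  \<comment> \<open>The supremum of a constant family is that constant only over a nonempty index
    set.\<close>
  moreover have "{d. d division_of {a..b}} \<noteq> {}"
    using division_of_self[of a b] assms by auto
  ultimately show ?thesis unfolding total_variation_def by simp
qed

lemma lipschitz_algebra_AC_alg: "lipschitz_algebra AC_alg (top_of_set {0..1})"
proof
  show cont: "continuous_map (top_of_set {0..1}) euclidean f" if "f \<in> funs AC_alg" for f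
    using that absolutely_continuous_on_imp_continuous_on by (simp add: AC_alg_def)
  show "cmod (f x) \<le> alg_norm AC_alg f" if f: "f \<in> funs AC_alg" and x: "x \<in> points AC_alg" for f x
  proof -
    have "cmod (f x) \<le> sup_norm {0..1} f"
      using bounded_continuous_map_image[OF _ cont[OF f]] x
      by (simp add: AC_alg_def sup_norm_ge compact_space_subtopology)
    moreover have "0 \<le> total_variation 0 1 f"
      using f by (intro total_variation_nonneg) (auto simp: AC_alg_def)
    ultimately show ?thesis by (simp add: AC_alg_def)
  qed
  show "compact_space (top_of_set {0..1::real})" by (simp add: compact_space_subtopology)
  show "alg_norm AC_alg (fscale c (unit_fun AC_alg)) \<le> cmod c" for c
    by (simp add: AC_alg_def unit_fun_def sup_norm_const total_variation_const)
  show "0 \<in> funs AC_alg"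
    by (auto simp: AC_alg_def absolutely_continuous_on_def increment_sum_def intro: exI[of _ 1])
next
  fix f h :: "_ \<Rightarrow> complex" and L
  assume f: "f \<in> funs AC_alg" and h: "L-lipschitz_on (f ` points AC_alg) h"
  have "absolutely_continuous_on {0..1} (\<lambda>x. if x \<in> {0..1} then h (f x) else 0)"
    by (rule absolutely_continuous_on_lipschitz_compose[of _ f L h])
      (use f h in \<open>auto simp: AC_alg_def\<close>)
  then show "(\<lambda>x. if x \<in> points AC_alg then h (f x) else 0) \<in> funs AC_alg"
    by (simp add: AC_alg_def)
qed (auto simp: AC_alg_def intro: absolutely_continuous_on_add)

section \<open>The equivalences for the three algebras\<close>

theorem corollary3p8:
  shows "(\<forall>(X :: 'a topology) \<phi>.
            compact_space X \<and> Hausdorff_space X \<and>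
            multiplicative (C_alg X) \<phi> \<and> spectral (C_alg X) \<phi> \<longrightarrow>
            (character (C_alg X) \<phi> \<longleftrightarrow> norm_continuous (C_alg X) \<phi>) \<and>
            (norm_continuous (C_alg X) \<phi> \<longleftrightarrow>
               unit_fun (C_alg X) \<notin> cspan (alg_ker (C_alg X) \<phi>))) \<and>
         (\<forall>(m :: 'b metric) \<phi>.
            compact_space (mtopology_of m) \<and>
            multiplicative (Lip_alg m) \<phi> \<and> spectral (Lip_alg m) \<phi> \<longrightarrow>
            (character (Lip_alg m) \<phi> \<longleftrightarrow> norm_continuous (Lip_alg m) \<phi>) \<and>
            (norm_continuous (Lip_alg m) \<phi> \<longleftrightarrow>
               unit_fun (Lip_alg m) \<notin> cspan (alg_ker (Lip_alg m) \<phi>))) \<and>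
         (\<forall>\<phi>.
            multiplicative AC_alg \<phi> \<and> spectral AC_alg \<phi> \<longrightarrow>
            (character AC_alg \<phi> \<longleftrightarrow> norm_continuous AC_alg \<phi>) \<and>
            (norm_continuous AC_alg \<phi> \<longleftrightarrow>
               unit_fun AC_alg \<notin> cspan (alg_ker AC_alg \<phi>)))"
proof (rule conjI[OF _ conjI]; intro allI impI; elim conjE)
  fix X :: "'a topology" and \<phi>
  assume "compact_space X" "multiplicative (C_alg X) \<phi>" "spectral (C_alg X) \<phi>"
  then interpret multiplicative_spectral "C_alg X" X \<phi>
    by (intro multiplicative_spectral.intro lipschitz_algebra_C_alg
      multiplicative_spectral_axioms.intro)
  show "(character (C_alg X) \<phi> \<longleftrightarrow> norm_continuous (C_alg X) \<phi>) \<and>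
    (norm_continuous (C_alg X) \<phi> \<longleftrightarrow> unit_fun (C_alg X) \<notin> cspan (alg_ker (C_alg X) \<phi>))"
    by (rule character_equivalences)
next
  fix m :: "'b metric" and \<phi>
  assume "compact_space (mtopology_of m)" "multiplicative (Lip_alg m) \<phi>" "spectral (Lip_alg m) \<phi>"
  then interpret multiplicative_spectral "Lip_alg m" "mtopology_of m" \<phi>
    by (intro multiplicative_spectral.intro lipschitz_algebra_Lip_alg
      multiplicative_spectral_axioms.intro)
  show "(character (Lip_alg m) \<phi> \<longleftrightarrow> norm_continuous (Lip_alg m) \<phi>) \<and>
    (norm_continuous (Lip_alg m) \<phi> \<longleftrightarrow> unit_fun (Lip_alg m) \<notin> cspan (alg_ker (Lip_alg m) \<phi>))"
    by (rule character_equivalences)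
next
  fix \<phi>
  assume "multiplicative AC_alg \<phi>" "spectral AC_alg \<phi>"
  then interpret multiplicative_spectral AC_alg "top_of_set {0..1}" \<phi>
    by (intro multiplicative_spectral.intro lipschitz_algebra_AC_alg
      multiplicative_spectral_axioms.intro)
  show "(character AC_alg \<phi> \<longleftrightarrow> norm_continuous AC_alg \<phi>) \<and>
    (norm_continuous AC_alg \<phi> \<longleftrightarrow> unit_fun AC_alg \<notin> cspan (alg_ker AC_alg \<phi>))"
    by (rule character_equivalences)
qed

end
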